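(* Fix $k\in\mathbb{P}$ and suppose $u,v\in[k,\infty)^*$ are such that there is a rearrangement $f:\mathbb{P}^*\to\mathbb{P}^*$ witnessing $u\sim_s v$. Then for any two words $y,z\in[1,k]^*$ there is a rearrangement $g:\mathbb{P}^*\to\mathbb{P}^*$ witnessing $yuz\sim_s yvz$.
   Context: $\mathbb{P}$ is the positive integers; $\mathbb{P}^*$ the finite words over $\mathbb{P}$; $[k,\infty)^*$ and $[1,k]^*$ are words with all letters in those integer intervals; juxtaposition is concatenation. Generalized factor order: $u\le w$ iff there is a factor $w'$ of $w$ (consecutive letters) with $|w'|=|u|$ and $u_i\le w'_i$ for all $i$; if $w'$ starts at the $j$th letter of $w$, $j$ is an embedding index, and $\mathrm{Em}(u,w)$ is the set of these. The weight of $w=w_1\cdots w_\ell$ is $t^\ell x^{w_1+\cdots+w_\ell}$. A weight-preserving bijection $f:\mathbb{P}^*\to\mathbb{P}^*$ witnesses the strong Wilf equivalence $u\sim_s v$ if $\mathrm{Em}(u,w)=\mathrm{Em}(v,f(w))$ for all $w\in\mathbb{P}^*$. A map $f$ is a rearrangement if $f(w)$ is a permutation of the letters of $w$ for every $w$. *)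

theory Defs
  imports "HOL-Library.Multiset" "HOL-Computational_Algebra.Polynomial"
begin

text \<open>Words are lists of natural numbers; positivity of the letters is imposed by membership in
  \<open>positive_words\<close>.\<close>

definition positive_words :: "nat list set" where
  "positive_words = lists {1..}"

text \<open>Embedding indices are counted from 1. The factor may be empty: the empty word embeds in
  \<open>w\<close> at the positions \<open>1, \<dots>, length w + 1\<close>.\<close>

definition Em :: "nat list \<Rightarrow> nat list \<Rightarrow> nat set" where
  "Em u w = {j. \<exists>a w' b. w = a @ w' @ b \<and> j = length a + 1 \<and>
     length w' = length u \<and> (\<forall>i<length u. u ! i \<le> w' ! i)}"

text \<open>The monomial \<open>t ^ length w * x ^ sum_list w\<close> as an element of \<open>\<int>[x][t]\<close>:
  the outer variable is \<open>t\<close>, the inner one \<open>x\<close>.\<close>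

definition weight :: "nat list \<Rightarrow> int poly poly" where
  "weight w = monom (monom 1 (sum_list w)) (length w)"

text \<open>Maps on positive words are total functions on \<open>nat list\<close> whose values outside
  \<open>positive_words\<close> are irrelevant.\<close>

definition witnesses_strong_Wilf ::
    "(nat list \<Rightarrow> nat list) \<Rightarrow> nat list \<Rightarrow> nat list \<Rightarrow> bool" where
  "witnesses_strong_Wilf f u v \<longleftrightarrow>
     bij_betw f positive_words positive_words \<and>
     (\<forall>w\<in>positive_words. weight (f w) = weight w) \<and>
     (\<forall>w\<in>positive_words. Em u w = Em v (f w))"

definition rearrangement :: "(nat list \<Rightarrow> nat list) \<Rightarrow> bool" where
  "rearrangement f \<longleftrightarrow> (\<forall>w\<in>positive_words. mset (f w) = mset w)"

end

theory Submission
  imports Defs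
begin

text \<open>A rearrangement witnessing \<open>u \<sim>\<^sub>s v\<close> restricts to a bijection of the words over \<open>[k,\<infinity>)\<close>. Apply it to
  every maximal run of letters \<open>\<ge> k\<close> of a word and leave the letters \<open>< k\<close> alone. An occurrence of
  \<open>u\<close> or \<open>v\<close> lies inside a single run, so \<open>Em u w = Em v (g w)\<close> for the resulting map \<open>g\<close>. Every
  position either keeps its letter or carries letters \<open>\<ge> k\<close> before and after, so the embeddings of
  words over \<open>[1,k]\<close> do not change.\<close>

section \<open>Embeddings in terms of positions, counted from 0\<close>

lemma Suc_in_Em_iff:
  "Suc i \<in> Em u w \<longleftrightarrow> i + length u \<le> length w \<and> (\<forall>l<length u. u ! l \<le> w ! (i + l))"
proof
  assume "Suc i \<in> Em u w"
  then show "i + length u \<le> length w \<and> (\<forall>l<length u. u ! l \<le> w ! (i + l))"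
    by (auto simp: Em_def nth_append)
next
  assume R: "i + length u \<le> length w \<and> (\<forall>l<length u. u ! l \<le> w ! (i + l))"
  have "w = take i w @ take (length u) (drop i w) @ drop (length u) (drop i w)"
    by (simp only: append_take_drop_id)
  moreover have "Suc i = length (take i w) + 1" "length (take (length u) (drop i w)) = length u"
    "\<forall>l<length u. u ! l \<le> take (length u) (drop i w) ! l"
    using R by auto
  ultimately show "Suc i \<in> Em u w"
    unfolding Em_def by blast
qed

lemma zero_notin_Em: "0 \<notin> Em u w"
  by (simp add: Em_def)

lemma Em_eqI:
  assumes "\<And>i. Suc i \<in> Em u w \<longleftrightarrow> Suc i \<in> Em u' w'"
  shows "Em u w = Em u' w'"
proof (rule set_eqI)
  show "j \<in> Em u w \<longleftrightarrow> j \<in> Em u' w'" for j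
    using assms by (cases j) (auto simp: zero_notin_Em)
qed

text \<open>This lets the factors of \<open>y @ u @ z\<close> be treated separately, each at its own
  offset.\<close>

lemma Suc_in_Em_append:
  "Suc i \<in> Em (a @ b) w \<longleftrightarrow> Suc i \<in> Em a w \<and> Suc (i + length a) \<in> Em b w"
proof -
  have "(\<forall>l<length a + length b. (a @ b) ! l \<le> w ! (i + l)) \<longleftrightarrow>
      (\<forall>l<length a. a ! l \<le> w ! (i + l)) \<and> (\<forall>l<length b. b ! l \<le> w ! (i + length a + l))"
    (is "?L \<longleftrightarrow> ?R")
  proof
    assume L: ?L
    have "a ! l \<le> w ! (i + l)" if "l < length a" for l
      using L[rule_format, of l] that by (simp add: nth_append)
    moreover have "b ! l \<le> w ! (i + length a + l)" if "l < length b" for l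
      using L[rule_format, of "length a + l"] that by (simp add: add.assoc)
    ultimately show ?R by blast
  next
    assume R: ?R
    show ?L
    proof (intro allI impI)
      fix l assume "l < length a + length b"
      then show "(a @ b) ! l \<le> w ! (i + l)"
        using R[THEN conjunct2, rule_format, of "l - length a"] R[THEN conjunct1]
        by (auto simp: nth_append)
    qed
  qed
  then show ?thesis
    by (auto simp: Suc_in_Em_iff add.assoc)
qed

text \<open>A factor covering \<open>x\<close> would need \<open>x\<close> to dominate a letter of
  \<open>u\<close>, but those are at least \<open>k\<close>. So every embedding lies entirely in
  \<open>r\<close> or entirely in \<open>s\<close>.\<close>

lemma Em_append_Cons:
  assumes "u \<noteq> []" "u \<in> lists {k..}" "x < k"
  shows "Em u (r @ x # s) = Em u r \<union> (\<lambda>j. Suc (length r) + j) ` Em u s"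
proof (rule set_eqI)
  fix j
  show "j \<in> Em u (r @ x # s) \<longleftrightarrow> j \<in> Em u r \<union> (\<lambda>j. Suc (length r) + j) ` Em u s"
  proof (cases j)
    case 0
    then show ?thesis by (auto simp: zero_notin_Em)
  next
    case (Suc i)
    have ge: "k \<le> u ! l" if "l < length u" for l
      using assms(2) that by (auto simp: in_lists_conv_set)
    have pos: "0 < length u" using assms(1) by simp
    \<comment> \<open>The letter \<open>x\<close> has position \<open>length r\<close>: the factor
      starting at \<open>i\<close> ends before it, covers it, or starts after it.\<close>
    consider "i + length u \<le> length r" | "i \<le> length r" "length r < i + length u" | "length r < i"
      by linarith
    then show ?thesis
    proof cases
      case 1
      then have "Suc i \<in> Em u (r @ x # s) \<longleftrightarrow> Suc i \<in> Em u r"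
        by (auto simp: Suc_in_Em_iff nth_append)
      moreover have "Suc i \<notin> (\<lambda>j. Suc (length r) + j) ` Em u s"
        using 1 pos by (auto simp: zero_notin_Em)
      ultimately show ?thesis using Suc by simp
    next
      case 2
      have "Suc i \<notin> Em u (r @ x # s)"
      proof
        assume "Suc i \<in> Em u (r @ x # s)"
        \<comment> \<open>This is the index of the letter of \<open>u\<close> that is compared with
          \<open>x\<close>.\<close>
        moreover have "length r - i < length u" using 2 pos by linarith
        ultimately have "u ! (length r - i) \<le> (r @ x # s) ! (i + (length r - i))"
          unfolding Suc_in_Em_iff by blast
        then show False
          using ge[OF \<open>length r - i < length u\<close>] 2 assms(3) by simp
      qed
      moreover have "Suc i \<notin> Em u r" using 2 by (simp add: Suc_in_Em_iff)
      moreover have "Suc i \<notin> (\<lambda>j. Suc (length r) + j) ` Em u s"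
        using 2 zero_notin_Em[of u s] by (auto simp: image_iff)
      ultimately show ?thesis using Suc by simp
    next
      case 3
      then obtain m where m: "i = Suc (length r + m)"
        using less_iff_Suc_add by auto
      have nth: "(r @ x # s) ! (i + l) = s ! (m + l)" for l
        by (simp add: m nth_append)
      have "Suc i \<in> Em u (r @ x # s) \<longleftrightarrow> Suc m \<in> Em u s"
        unfolding Suc_in_Em_iff nth by (simp add: m)
      moreover have "Suc i \<notin> Em u r" using 3 by (simp add: Suc_in_Em_iff)
      moreover have "Suc i \<in> (\<lambda>j. Suc (length r) + j) ` Em u s \<longleftrightarrow> Suc m \<in> Em u s"
        by (auto simp: m image_iff)
      ultimately show ?thesis using Suc by simp
    qed
  qed
qed

text \<open>Letters that are at least \<open>k\<close> dominate every letter of \<open>y\<close>, so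
  replacing one of them by another changes no comparison.\<close>

lemma Em_cong_ge:
  assumes "list_all2 (\<lambda>a b. a = b \<or> k \<le> a \<and> k \<le> b) w w'" "y \<in> lists {1..k}"
  shows "Em y w = Em y w'"
proof (rule Em_eqI)
  fix i
  have le: "y ! l \<le> k" if "l < length y" for l
    using assms(2) that by (auto simp: in_lists_conv_set)
  have "y ! l \<le> w ! (i + l) \<longleftrightarrow> y ! l \<le> w' ! (i + l)"
    if "l < length y" "i + l < length w" for l
    using list_all2_nthD[OF assms(1) that(2)] le[OF that(1)] by linarith
  then show "Suc i \<in> Em y w \<longleftrightarrow> Suc i \<in> Em y w'"
    using list_all2_lengthD[OF assms(1)] by (fastforce simp: Suc_in_Em_iff)
qed

section \<open>Consequences of being a rearrangement\<close>

lemma Em_replicate: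
  assumes "\<And>a. a \<in> set u \<Longrightarrow> a \<le> M"
  shows "Suc i \<in> Em u (replicate n M) \<longleftrightarrow> i + length u \<le> n"
  using assms by (auto simp: Suc_in_Em_iff)

lemma mset_eq_replicate:
  assumes "mset w = mset (replicate n x)"
  shows "w = replicate n x"
proof -
  have "length w = n" "set w \<subseteq> {x}"
    using mset_eq_length[OF assms] mset_eq_setD[OF assms] by auto
  then show ?thesis by (metis insertE empty_iff replicate_eqI subsetD)
qed

text \<open>A constant word is its own only permutation, so \<open>f\<close> fixes it. If its letter
  is large, its embedding sets depend only on the lengths of \<open>u\<close> and
  \<open>v\<close>.\<close>

lemma rearrangement_strong_Wilf_length:
  assumes "rearrangement f" "witnesses_strong_Wilf f u v"
  shows "length u = length v"
proof -
  \<comment> \<open>\<open>M\<close> bounds all letters of \<open>u\<close> and \<open>v\<close>;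
    the \<open>Suc\<close> keeps it positive even if both words are empty.\<close>
  define M where "M = Suc (sum_list u + sum_list v)"
  define w where "w = replicate (length u + length v) M"
  have w: "w \<in> positive_words"
    by (auto simp: w_def M_def positive_words_def)
  then have "f w = w"
    using assms(1) unfolding rearrangement_def w_def by (intro mset_eq_replicate) blast
  then have "Em u w = Em v w"
    using assms(2) w by (metis witnesses_strong_Wilf_def)
  moreover have "a \<le> M" if "a \<in> set u \<union> set v" for a
    using that member_le_sum_list[of a u] member_le_sum_list[of a v] by (auto simp: M_def)
  ultimately have "i + length u \<le> length u + length v \<longleftrightarrow> i + length v \<le> length u + length v" for i
    using Em_replicate[of u M i "length u + length v"] Em_replicate[of v M i "length u + length v"]
    unfolding w_def by blast
  \<comment> \<open>The first instance gives \<open>length u \<le> length v\<close>, the second the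
    converse.\<close>
  from this[of "length u"] this[of "length v"] show ?thesis by simp
qed

text \<open>\<open>f\<close> preserves the set of letters, so the preimage of a word over
  \<open>A\<close> is again a word over \<open>A\<close>.\<close>

lemma rearrangement_bij_betw_lists:
  assumes "rearrangement f" "bij_betw f positive_words positive_words" "A \<subseteq> {1..}"
  shows "bij_betw f (lists A) (lists A)"
proof -
  have sub: "lists A \<subseteq> positive_words"
    unfolding positive_words_def using assms(3) by (rule lists_mono)
  have set_f: "set (f w) = set w" if "w \<in> positive_words" for w
    using assms(1) that by (metis mset_eq_setD rearrangement_def)
  have "f ` lists A = lists A"
  proof
    show "f ` lists A \<subseteq> lists A"
      using sub set_f by (fastforce simp: in_lists_conv_set)
    show "lists A \<subseteq> f ` lists A"
    proof
      fix w assume w: "w \<in> lists A"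
      then obtain w' where "w' \<in> positive_words" "w = f w'"
        using sub assms(2) unfolding bij_betw_def by blast
      with w set_f show "w \<in> f ` lists A"
        by (auto simp: in_lists_conv_set)
    qed
  qed
  then show ?thesis
    using assms(2) sub by (auto simp: bij_betw_def intro: inj_on_subset)
qed

section \<open>Applying a map to each maximal run of letters at least \<open>k\<close>\<close>

function map_runs :: "nat \<Rightarrow> (nat list \<Rightarrow> nat list) \<Rightarrow> nat list \<Rightarrow> nat list" where
  "map_runs k f w = f (takeWhile (\<lambda>a. k \<le> a) w) @
     (case dropWhile (\<lambda>a. k \<le> a) w of [] \<Rightarrow> [] | x # s \<Rightarrow> x # map_runs k f s)"
  by auto
termination
proof (relation "Wellfounded.measure (\<lambda>(k, f, w). length w)")
  fix k :: nat and f :: "nat list \<Rightarrow> nat list" and w x s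
  assume "dropWhile (\<lambda>a. k \<le> a) w = x # s"
  then have "length s < length (dropWhile (\<lambda>a. k \<le> a) w)" by simp
  then show "((k, f, s), (k, f, w)) \<in> Wellfounded.measure (\<lambda>(k, f, w). length w)"
    using length_dropWhile_le[of "\<lambda>a. k \<le> a" w] by simp
qed simp

declare map_runs.simps [simp del]

lemma map_runs_run:
  assumes "r \<in> lists {k..}"
  shows "map_runs k f r = f r"
proof -
  have "takeWhile (\<lambda>a. k \<le> a) r = r" "dropWhile (\<lambda>a. k \<le> a) r = []"
    using assms by (auto simp: in_lists_conv_set takeWhile_eq_all_conv)
  then show ?thesis unfolding map_runs.simps[of k f r] by (simp only: list.case append_Nil2)
qed

text \<open>With \<open>r = []\<close> this covers adjacent letters below \<open>k\<close>: the run
  between them is empty and contributes \<open>f []\<close>.\<close>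

lemma map_runs_append_Cons:
  assumes "r \<in> lists {k..}" "x < k"
  shows "map_runs k f (r @ x # s) = f r @ x # map_runs k f s"
proof -
  have "\<forall>a\<in>set r. k \<le> a"
    using assms(1) by (auto simp: in_lists_conv_set)
  then have "takeWhile (\<lambda>a. k \<le> a) (r @ x # s) = r" "dropWhile (\<lambda>a. k \<le> a) (r @ x # s) = x # s"
    using assms(2) by (auto simp: takeWhile_append2 dropWhile_append2)
  then show ?thesis by (simp add: map_runs.simps[of k f "r @ x # s"])
qed

text \<open>Cutting at the first letter below \<open>k\<close> leaves a possibly empty run and a
  shorter rest. The two cases match \<open>map_runs_run\<close> and
  \<open>map_runs_append_Cons\<close>.\<close>

lemma runs_induct [case_names run break]:
  fixes w :: "nat list"
  assumes run: "\<And>r. r \<in> lists {k..} \<Longrightarrow> P r"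
    and "break": "\<And>r x s. r \<in> lists {k..} \<Longrightarrow> x < k \<Longrightarrow> P s \<Longrightarrow> P (r @ x # s)"
  shows "P w"
proof (induction w rule: length_induct)
  case (1 w)
  show ?case
  proof (cases "w \<in> lists {k..}")
    case True
    then show ?thesis by (rule run)
  next
    case False
    then have "\<exists>x\<in>set w. x < k" by (auto simp: in_lists_conv_set not_le)
    then obtain r x s where w: "w = r @ x # s" "x < k" "\<forall>a\<in>set r. \<not> a < k"
      using split_list_first_prop[of w "\<lambda>x. x < k"] by blast
    moreover from w have "r \<in> lists {k..}" by (auto simp: in_lists_conv_set)
    moreover from w 1 have "P s" by simp
    ultimately show ?thesis using "break" by simp
  qed
qed

lemma mset_map_runs:
  assumes "\<And>r. r \<in> lists {k..} \<Longrightarrow> mset (f r) = mset r"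
  shows "mset (map_runs k f w) = mset w"
  by (induction w rule: runs_induct[of k])
    (simp_all add: assms map_runs_run map_runs_append_Cons)

text \<open>Since \<open>f\<close> sends runs to words over the same letters, the image is cut at
  the same letters below \<open>k\<close>, and \<open>h\<close> undoes \<open>f\<close> run by
  run.\<close>

lemma map_runs_comp_id:
  assumes "\<And>r. r \<in> lists {k..} \<Longrightarrow> f r \<in> lists {k..}" "\<And>r. r \<in> lists {k..} \<Longrightarrow> h (f r) = r"
  shows "map_runs k h (map_runs k f w) = w"
  by (induction w rule: runs_induct[of k])
    (simp_all add: assms map_runs_run map_runs_append_Cons)

text \<open>This is the hypothesis of \<open>Em_cong_ge\<close>: letters below \<open>k\<close> stay
  in place, and each run becomes an equally long word of letters at least \<open>k\<close>.\<close>

lemma map_runs_pointwise: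
  assumes "\<And>r. r \<in> lists {k..} \<Longrightarrow> mset (f r) = mset r"
  shows "list_all2 (\<lambda>a b. a = b \<or> k \<le> a \<and> k \<le> b) w (map_runs k f w)"
proof -
  have pw: "list_all2 (\<lambda>a b. a = b \<or> k \<le> a \<and> k \<le> b) r (f r)" if r: "r \<in> lists {k..}" for r
  proof -
    have "length (f r) = length r" "set (f r) = set r"
      using assms[OF r] by (auto dest: mset_eq_length mset_eq_setD)
    moreover from this r have "k \<le> r ! i \<and> k \<le> f r ! i" if "i < length r" for i
      using that by (metis atLeast_iff in_lists_conv_set nth_mem)
    ultimately show ?thesis by (simp add: list_all2_conv_all_nth)
  qed
  show ?thesis
  proof (induction w rule: runs_induct[of k])
    case (run r)
    then show ?case by (simp only: map_runs_run pw)
  next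
    case ("break" r x s)
    then show ?case
      using list_all2_appendI[OF pw[OF "break"(1)]] by (simp only: map_runs_append_Cons) simp
  qed
qed

lemma Em_map_runs:
  assumes "u \<noteq> []" "v \<noteq> []" "u \<in> lists {k..}" "v \<in> lists {k..}"
    and "\<And>r. r \<in> lists {k..} \<Longrightarrow> mset (f r) = mset r"
    and "\<And>r. r \<in> lists {k..} \<Longrightarrow> Em u r = Em v (f r)"
  shows "Em u w = Em v (map_runs k f w)"
proof (induction w rule: runs_induct[of k])
  case (run r)
  then show ?case by (simp add: assms(6) map_runs_run)
next
  case ("break" r x s)
  \<comment> \<open>Equal lengths make the shift of the embeddings in \<open>s\<close> the same on
    both sides.\<close>
  have "length (f r) = length r"
    using assms(5)[OF "break"(1)] by (rule mset_eq_length)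
  then show ?case
    using "break" Em_append_Cons[OF assms(1,3)] Em_append_Cons[OF assms(2,4)]
    by (simp add: assms(6) map_runs_append_Cons)
qed

lemma bij_betw_map_runs:
  assumes "1 \<le> k" "bij_betw f (lists {k..}) (lists {k..})"
    and mset: "\<And>r. r \<in> lists {k..} \<Longrightarrow> mset (f r) = mset r"
  shows "bij_betw (map_runs k f) positive_words positive_words"
proof -
  \<comment> \<open>The inverse of \<open>f\<close> on runs; applied run by run it inverts
    \<open>map_runs k f\<close>.\<close>
  define h where "h = inv_into (lists {k..}) f"
  have f: "f r \<in> lists {k..}" "h (f r) = r" if "r \<in> lists {k..}" for r
    using assms(2) that unfolding h_def
    by (auto simp: bij_betw_inv_into_left bij_betw_apply)
  have h: "h r \<in> lists {k..}" "f (h r) = r" if "r \<in> lists {k..}" for r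
    using bij_betw_apply[OF bij_betw_inv_into[OF assms(2)] that]
      bij_betw_inv_into_right[OF assms(2) that] by (simp_all only: h_def)
  have mset_h: "mset (h r) = mset r" if "r \<in> lists {k..}" for r
    using mset[OF h(1)[OF that]] h(2)[OF that] by simp
  have closed: "map_runs k f' w \<in> positive_words"
    if "w \<in> positive_words" "\<And>r. r \<in> lists {k..} \<Longrightarrow> mset (f' r) = mset r" for f' w
    using that(1) mset_eq_setD[OF mset_map_runs[of k f' w, OF that(2)]]
    by (auto simp: positive_words_def in_lists_conv_set)
  show ?thesis
  proof (rule bij_betw_byWitness[where f' = "map_runs k h"])
    show "\<forall>w\<in>positive_words. map_runs k h (map_runs k f w) = w"
      using map_runs_comp_id[of k f h] f by blast
    show "\<forall>w\<in>positive_words. map_runs k f (map_runs k h w) = w"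
      using map_runs_comp_id[of k h f] h by blast
    show "map_runs k f ` positive_words \<subseteq> positive_words"
      using closed mset by blast
    show "map_runs k h ` positive_words \<subseteq> positive_words"
      using closed mset_h by blast
  qed
qed

section \<open>Weights, and the rearrangement for the extended words\<close>

lemma weight_cong_mset:
  assumes "mset w = mset w'"
  shows "weight w = weight w'"
  using mset_eq_length[OF assms] assms by (metis sum_mset_sum_list weight_def)

theorem theorem5p4:
  fixes k :: nat and u v y z :: "nat list"
  assumes "k \<ge> 1"
    and "u \<in> lists {k..}" and "v \<in> lists {k..}"
    and "\<exists>f. rearrangement f \<and> witnesses_strong_Wilf f u v"
    and "y \<in> lists {1..k}" and "z \<in> lists {1..k}"
  shows "\<exists>g. rearrangement g \<and> witnesses_strong_Wilf g (y @ u @ z) (y @ v @ z)"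
proof -
  obtain f where f: "rearrangement f" "witnesses_strong_Wilf f u v"
    using assms(4) by blast
  define g where "g = map_runs k f"
  have sub: "lists {k..} \<subseteq> positive_words"
    unfolding positive_words_def using assms(1) by (intro lists_mono) auto
  have mset: "mset (f r) = mset r" if "r \<in> lists {k..}" for r
    using f(1) sub that unfolding rearrangement_def by blast
  have mset_g: "mset (g w) = mset w" for w
    unfolding g_def using mset by (rule mset_map_runs)
  have len: "length u = length v"
    using f by (rule rearrangement_strong_Wilf_length)
  have "bij_betw f (lists {k..}) (lists {k..})"
    using f assms(1) by (intro rearrangement_bij_betw_lists) (auto simp: witnesses_strong_Wilf_def)
  then have bij: "bij_betw g positive_words positive_words"
    unfolding g_def using assms(1) mset by (intro bij_betw_map_runs) blast+
  have Em_small: "Em a w = Em a (g w)" if "a \<in> lists {1..k}" for a w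
    unfolding g_def using map_runs_pointwise[OF mset] that by (rule Em_cong_ge)
  have Em_uv: "Em u w = Em v (g w)" for w
  \<comment> \<open>\<open>Em_map_runs\<close> is for nonempty words. If \<open>u\<close> is empty,
    so is \<open>v\<close>, and the empty word counts as a word over \<open>[1,k]\<close>.\<close>
  proof (cases "u = []")
    case True
    then show ?thesis
      using len Em_small[of "[]" w] by simp
  next
    case False
    moreover have "Em u r = Em v (f r)" if "r \<in> lists {k..}" for r
      using f(2) sub that unfolding witnesses_strong_Wilf_def by blast
    ultimately show ?thesis
      unfolding g_def using len assms(2,3) mset by (intro Em_map_runs) auto
  qed
  \<comment> \<open>As \<open>u\<close> and \<open>v\<close> have equal length, \<open>z\<close> is
    tested at the same offset on both sides.\<close>
  have "Em (y @ u @ z) w = Em (y @ v @ z) (g w)" for w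
    using Em_small[OF assms(5)] Em_small[OF assms(6)] Em_uv
    by (intro Em_eqI) (simp add: Suc_in_Em_append len)
  then have "witnesses_strong_Wilf g (y @ u @ z) (y @ v @ z)"
    using bij weight_cong_mset[OF mset_g] by (simp add: witnesses_strong_Wilf_def)
  moreover have "rearrangement g"
    by (simp add: rearrangement_def mset_g)
  ultimately show ?thesis by blast
qed

end
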